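(* Let $G$ be a connected simple cubic graph of girth 4, let $M(G)$ be a $\Pi$-map of $G$, and let $\mu$ be an ETGC of $M(G)$ with vertex coloring $\mu_V=\mu|_{V(G)}$. Then, corresponding to $\mu_V$, there are two mutually orthogonal edge colorings $\mu^D$ and $\mu^R$ of $E(G)$ leading to two mutually orthogonal ETGCs, namely a DETGC $\mu_V^D=(\mu_V,\mu^D)$ and an RETGC $\mu_V^R=(\mu_V,\mu^R)$. Moreover, either $\mu=\mu_V^D$ or $\mu=\mu_V^R$.
   Context: Write $[3]_0=\{0,1,2,3\}$. $G$ is a connected simple cubic graph of girth 4. A set $S_0\subseteq V(G)$ is an efficient dominating set (EDS) if $|N_G[v]\cap S_0|=1$ for every $v\in V(G)$. A total coloring colors vertices and edges so that no two incident or adjacent elements get the same color. An efficient total coloring (ETC) of $G$ is a total coloring $\mu:V(G)\cup E(G)\to[3]_0$ such that for each vertex $v$ the restriction of $\mu$ to $N_G[v]$ is a bijection onto $[3]_0$, and the four vertex color classes partition $V(G)$ into EDSs. An ETGC is an ETC in which every 4-cycle of $G$ has each of the four colors exactly once on its vertices and exactly once on its edges. Two ETCs are mutually orthogonal if they have the same vertex coloring and differ in color on every edge; their induced edge colorings are then also called mutually orthogonal. A map $M(G)$ is an embedding of $G$ in a connected closed orientable surface $S$ of genus equal to the genus of $G$ such that the components of $S\setminus G$ are open disks; closures of these disks are the faces, and a belt is a face boundary cycle (an $\ell$-belt if it has length $\ell$). A vertex of $G$ in no 4-cycle of $G$ is a Y-vertex; an edge with both ends Y-vertices is a Y-edge.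 A $2\ell$-belt with consecutive edges $(e_1,\dots,e_{2\ell})$ is a Y-belt if its Y-edges, if any, occur only in opposite pairs $\{e_h,e_{h+\ell}\}$, $1\le h\le\ell$. $M(G)$ is a Y-map if all belts have even length and are Y-belts. A $\Pi$-map is a Y-map $M(G)$ for which $V(G)$ admits a partition into four EDSs, labelled $0,1,2,3$, such that the cyclic sequence of vertex colors of each $\ell$-belt has the form $(a,b,c,d)^{\ell/4}$ with $\{a,b,c,d\}=[3]_0$. Given an ETGC of a $\Pi$-map, a belt is directed (resp. reversed) if each color-0 edge $e$ on it lies in the clockwise (resp. counterclockwise) direction from a color-0 vertex $v$ of the belt, with distance 1 from $v$ to the nearest end-vertex of $e$. (Clockwise is with respect to the orientation of the face.) An ETGC is a DETGC (resp. RETGC) if every belt is directed (resp. reversed).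
   Formalization: The vertex coloring of the ETGC μ is assumed to be one of the labelled EDS partitions that make M(G) a Π-map (belts colored (a,b,c,d)^{ℓ/4}); for arbitrary ETGCs the claim fails, e.g. on the truncated 4×4 square grid on the torus. *)

theory Defs
  imports "HOL-Library.FuncSet" "HOL-Library.Disjoint_Sets" "HOL-Library.Extended_Nat"
    "HOL-Combinatorics.Orbits"
begin

section \<open>Simple graphs\<close>

text \<open>A simple graph is a pair \<open>V\<close>, \<open>E\<close> whose edges are two-element subsets of \<open>V\<close>. Graphs are
  finite: only finite graphs embed in a compact surface with all faces open disks.\<close>

definition simple_graph :: "'a set \<Rightarrow> 'a set set \<Rightarrow> bool" where
  "simple_graph V E \<longleftrightarrow> finite V \<and> (\<forall>e\<in>E. e \<subseteq> V \<and> card e = 2)"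

definition neighbors :: "'a set set \<Rightarrow> 'a \<Rightarrow> 'a set" where
  "neighbors E v = {u. {v, u} \<in> E}"

definition closed_neighbors :: "'a set set \<Rightarrow> 'a \<Rightarrow> 'a set" where
  "closed_neighbors E v = insert v (neighbors E v)"

definition connected_graph :: "'a set \<Rightarrow> 'a set set \<Rightarrow> bool" where
  "connected_graph V E \<longleftrightarrow> V \<noteq> {} \<and> (\<forall>u\<in>V. \<forall>v\<in>V. (u, v) \<in> {(x, y). {x, y} \<in> E}\<^sup>*)"

definition cubic_graph :: "'a set \<Rightarrow> 'a set set \<Rightarrow> bool" where
  "cubic_graph V E \<longleftrightarrow> (\<forall>v\<in>V. card (neighbors E v) = 3)"

text \<open>A closed walk is the cyclic list of its vertices; its \<open>i\<close>-th edge joins the vertex at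
  position \<open>i\<close> to the cyclically next one.\<close>

definition walk_edge :: "'a list \<Rightarrow> nat \<Rightarrow> 'a set" where
  "walk_edge p i = {p ! i, p ! (Suc i mod length p)}"

definition graph_cycle :: "'a set set \<Rightarrow> 'a list \<Rightarrow> bool" where
  "graph_cycle E p \<longleftrightarrow> length p \<ge> 3 \<and> distinct p \<and> (\<forall>i<length p. walk_edge p i \<in> E)"

definition graph_girth :: "'a set set \<Rightarrow> enat" where
  "graph_girth E = (INF p\<in>{p. graph_cycle E p}. enat (length p))"

definition EDS :: "'a set \<Rightarrow> 'a set set \<Rightarrow> 'a set \<Rightarrow> bool" where
  "EDS V E S \<longleftrightarrow> S \<subseteq> V \<and> (\<forall>v\<in>V. card (closed_neighbors E v \<inter> S) = 1)"


section \<open>Efficient total colorings\<close>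

definition colors :: "nat set" where
  "colors = {0, 1, 2, 3}"

definition color_class :: "'a set \<Rightarrow> ('a \<Rightarrow> nat) \<Rightarrow> nat \<Rightarrow> 'a set" where
  "color_class V c i = {v\<in>V. c v = i}"

definition EDS_partition :: "'a set \<Rightarrow> 'a set set \<Rightarrow> ('a \<Rightarrow> nat) \<Rightarrow> bool" where
  "EDS_partition V E c \<longleftrightarrow>
     c \<in> V \<rightarrow>\<^sub>E colors \<and> partition_on V (color_class V c ` colors) \<and>
     (\<forall>i\<in>colors. EDS V E (color_class V c i))"

text \<open>A total coloring is a pair of a vertex coloring and an edge coloring. Both are extensional
  functions, so that equality of colorings is equality on \<open>V\<close> and on \<open>E\<close>.\<close>

type_synonym 'a coloring = "('a \<Rightarrow> nat) \<times> ('a set \<Rightarrow> nat)"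

definition total_coloring :: "'a set \<Rightarrow> 'a set set \<Rightarrow> 'a coloring \<Rightarrow> bool" where
  "total_coloring V E \<mu> \<longleftrightarrow>
     fst \<mu> \<in> V \<rightarrow>\<^sub>E colors \<and> snd \<mu> \<in> E \<rightarrow>\<^sub>E colors \<and>
     (\<forall>u v. {u, v} \<in> E \<longrightarrow> fst \<mu> u \<noteq> fst \<mu> v) \<and>
     (\<forall>e\<in>E. \<forall>f\<in>E. e \<noteq> f \<and> e \<inter> f \<noteq> {} \<longrightarrow> snd \<mu> e \<noteq> snd \<mu> f) \<and>
     (\<forall>e\<in>E. \<forall>v\<in>e. fst \<mu> v \<noteq> snd \<mu> e)"

definition ETC :: "'a set \<Rightarrow> 'a set set \<Rightarrow> 'a coloring \<Rightarrow> bool" where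
  "ETC V E \<mu> \<longleftrightarrow>
     total_coloring V E \<mu> \<and>
     (\<forall>v\<in>V. bij_betw (fst \<mu>) (closed_neighbors E v) colors) \<and>
     EDS_partition V E (fst \<mu>)"

definition ETGC :: "'a set \<Rightarrow> 'a set set \<Rightarrow> 'a coloring \<Rightarrow> bool" where
  "ETGC V E \<mu> \<longleftrightarrow>
     ETC V E \<mu> \<and>
     (\<forall>p. graph_cycle E p \<and> length p = 4 \<longrightarrow>
        bij_betw (fst \<mu>) (set p) colors \<and> bij_betw (snd \<mu>) (walk_edge p ` {..<4}) colors)"

definition orthogonal_ETCs :: "'a set \<Rightarrow> 'a set set \<Rightarrow> 'a coloring \<Rightarrow> 'a coloring \<Rightarrow> bool" where
  "orthogonal_ETCs V E \<mu> \<nu> \<longleftrightarrow>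
     ETC V E \<mu> \<and> ETC V E \<nu> \<and> fst \<mu> = fst \<nu> \<and> (\<forall>e\<in>E. snd \<mu> e \<noteq> snd \<nu> e)"

definition orthogonal_edge_colorings ::
    "'a set \<Rightarrow> 'a set set \<Rightarrow> ('a set \<Rightarrow> nat) \<Rightarrow> ('a set \<Rightarrow> nat) \<Rightarrow> bool" where
  "orthogonal_edge_colorings V E f g \<longleftrightarrow> (\<exists>c. orthogonal_ETCs V E (c, f) (c, g))"


section \<open>Maps and belts\<close>

text \<open>An embedding of a connected graph in an oriented closed surface with all faces open disks is
  represented, as usual, by its rotation system: \<open>\<rho> v u\<close> is the neighbor of \<open>v\<close> following \<open>u\<close> in the
  counterclockwise order around \<open>v\<close>. A dart is a directed edge. Whoever walks along the dart
  \<open>(u, v)\<close> with a face on the right continues along that face through \<open>(v, \<rho> v u)\<close>; walking with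
  the face on the right means going clockwise around the face. So the faces are the orbits of
  \<open>face_step\<close>.\<close>

definition rotation_system :: "'a set \<Rightarrow> 'a set set \<Rightarrow> ('a \<Rightarrow> 'a \<Rightarrow> 'a) \<Rightarrow> bool" where
  "rotation_system V E \<rho> \<longleftrightarrow> (\<forall>v\<in>V. cyclic_on (\<rho> v) (neighbors E v))"

definition darts :: "'a set set \<Rightarrow> ('a \<times> 'a) set" where
  "darts E = {(u, v). {u, v} \<in> E}"

definition face_step :: "('a \<Rightarrow> 'a \<Rightarrow> 'a) \<Rightarrow> 'a \<times> 'a \<Rightarrow> 'a \<times> 'a" where
  "face_step \<rho> d = (snd d, \<rho> (snd d) (fst d))"

definition map_faces :: "'a set set \<Rightarrow> ('a \<Rightarrow> 'a \<Rightarrow> 'a) \<Rightarrow> ('a \<times> 'a) set set" where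
  "map_faces E \<rho> = orbit (face_step \<rho>) ` darts E"

text \<open>The genus of the surface is given by Euler's formula. The genus of a graph is the least genus
  of a closed orientable surface in which it embeds; for a connected graph all faces of an
  embedding in such a surface are open disks, so rotation systems suffice.\<close>

definition has_genus :: "'a set \<Rightarrow> 'a set set \<Rightarrow> ('a \<Rightarrow> 'a \<Rightarrow> 'a) \<Rightarrow> nat \<Rightarrow> bool" where
  "has_genus V E \<rho> g \<longleftrightarrow>
     int (card V) - int (card E) + int (card (map_faces E \<rho>)) = 2 - 2 * int g"

definition graph_genus :: "'a set \<Rightarrow> 'a set set \<Rightarrow> nat" where
  "graph_genus V E = (LEAST g. \<exists>\<rho>. rotation_system V E \<rho> \<and> has_genus V E \<rho> g)"

definition graph_map :: "'a set \<Rightarrow> 'a set set \<Rightarrow> ('a \<Rightarrow> 'a \<Rightarrow> 'a) \<Rightarrow> bool" where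
  "graph_map V E \<rho> \<longleftrightarrow> rotation_system V E \<rho> \<and> has_genus V E \<rho> (graph_genus V E)"

text \<open>The belt of a face is the list of its boundary vertices in clockwise order. The starting point
  is arbitrary: with a list, all its rotations are belts. No face boundary is required to be a
  cycle: a closed walk that repeats vertices is admitted too.\<close>

definition belt :: "'a set set \<Rightarrow> ('a \<Rightarrow> 'a \<Rightarrow> 'a) \<Rightarrow> 'a list \<Rightarrow> bool" where
  "belt E \<rho> p \<longleftrightarrow>
     (\<exists>d\<in>darts E. p = map (\<lambda>i. fst ((face_step \<rho> ^^ i) d)) [0..<card (orbit (face_step \<rho>) d)])"


section \<open>Y-maps and Pi-maps\<close>

definition Y_vertex :: "'a set \<Rightarrow> 'a set set \<Rightarrow> 'a \<Rightarrow> bool" where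
  "Y_vertex V E v \<longleftrightarrow> v \<in> V \<and> \<not> (\<exists>p. graph_cycle E p \<and> length p = 4 \<and> v \<in> set p)"

definition Y_edge :: "'a set \<Rightarrow> 'a set set \<Rightarrow> 'a set \<Rightarrow> bool" where
  "Y_edge V E e \<longleftrightarrow> e \<in> E \<and> (\<forall>v\<in>e. Y_vertex V E v)"

definition Y_belt :: "'a set \<Rightarrow> 'a set set \<Rightarrow> 'a list \<Rightarrow> bool" where
  "Y_belt V E p \<longleftrightarrow>
     (\<exists>l. length p = 2 * l \<and>
        (\<forall>h<l. Y_edge V E (walk_edge p h) \<longleftrightarrow> Y_edge V E (walk_edge p (h + l))))"

definition Y_map :: "'a set \<Rightarrow> 'a set set \<Rightarrow> ('a \<Rightarrow> 'a \<Rightarrow> 'a) \<Rightarrow> bool" where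
  "Y_map V E \<rho> \<longleftrightarrow> graph_map V E \<rho> \<and> (\<forall>p. belt E \<rho> p \<longrightarrow> even (length p) \<and> Y_belt V E p)"

definition Pi_labelling :: "'a set \<Rightarrow> 'a set set \<Rightarrow> ('a \<Rightarrow> 'a \<Rightarrow> 'a) \<Rightarrow> ('a \<Rightarrow> nat) \<Rightarrow> bool" where
  "Pi_labelling V E \<rho> c \<longleftrightarrow>
     EDS_partition V E c \<and>
     (\<forall>p. belt E \<rho> p \<longrightarrow>
        (\<exists>i j k l m. {i, j, k, l} = colors \<and> map c p = concat (replicate m [i, j, k, l])))"

definition Pi_map :: "'a set \<Rightarrow> 'a set set \<Rightarrow> ('a \<Rightarrow> 'a \<Rightarrow> 'a) \<Rightarrow> bool" where
  "Pi_map V E \<rho> \<longleftrightarrow> Y_map V E \<rho> \<and> (\<exists>c. Pi_labelling V E \<rho> c)"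

text \<open>An ETGC of a Pi-map, as opposed to an ETGC of its underlying graph, has as its vertex coloring
  one of the labelled partitions that make the map a Pi-map. The graph can have ETGCs with other
  vertex colorings, for which a belt need be neither directed nor reversed.\<close>

definition Pi_map_ETGC ::
    "'a set \<Rightarrow> 'a set set \<Rightarrow> ('a \<Rightarrow> 'a \<Rightarrow> 'a) \<Rightarrow> 'a coloring \<Rightarrow> bool" where
  "Pi_map_ETGC V E \<rho> \<mu> \<longleftrightarrow> Pi_map V E \<rho> \<and> ETGC V E \<mu> \<and> Pi_labelling V E \<rho> (fst \<mu>)"

text \<open>Belts are listed clockwise. The edge at position \<open>i\<close> has its ends at positions \<open>i\<close> and \<open>i + 1\<close>.
  It is reached from the vertex at position \<open>j\<close> clockwise after one step if \<open>i = j + 1\<close>, and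
  counterclockwise after one step if \<open>j = i + 2\<close>, positions being cyclic.\<close>

definition directed_belt :: "'a coloring \<Rightarrow> 'a list \<Rightarrow> bool" where
  "directed_belt \<mu> p \<longleftrightarrow>
     (\<forall>i<length p. snd \<mu> (walk_edge p i) = 0 \<longrightarrow>
        (\<exists>j<length p. fst \<mu> (p ! j) = 0 \<and> i = (j + 1) mod length p))"

definition reversed_belt :: "'a coloring \<Rightarrow> 'a list \<Rightarrow> bool" where
  "reversed_belt \<mu> p \<longleftrightarrow>
     (\<forall>i<length p. snd \<mu> (walk_edge p i) = 0 \<longrightarrow>
        (\<exists>j<length p. fst \<mu> (p ! j) = 0 \<and> j = (i + 2) mod length p))"

definition DETGC :: "'a set \<Rightarrow> 'a set set \<Rightarrow> ('a \<Rightarrow> 'a \<Rightarrow> 'a) \<Rightarrow> 'a coloring \<Rightarrow> bool" where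
  "DETGC V E \<rho> \<mu> \<longleftrightarrow> Pi_map_ETGC V E \<rho> \<mu> \<and> (\<forall>p. belt E \<rho> p \<longrightarrow> directed_belt \<mu> p)"

definition RETGC :: "'a set \<Rightarrow> 'a set set \<Rightarrow> ('a \<Rightarrow> 'a \<Rightarrow> 'a) \<Rightarrow> 'a coloring \<Rightarrow> bool" where
  "RETGC V E \<rho> \<mu> \<longleftrightarrow> Pi_map_ETGC V E \<rho> \<mu> \<and> (\<forall>p. belt E \<rho> p \<longrightarrow> reversed_belt \<mu> p)"

end

theory Submission
  imports Defs
begin

text \<open>Let \<open>c\<close> be the vertex coloring. Every closed neighborhood is rainbow, so the edge \<open>uv\<close> can only
  receive one of the two colors missing at its ends, that is, the color of one of the other two
  neighbors of \<open>u\<close>, which are \<open>\<rho> u v\<close> and \<open>\<rho> u (\<rho> u v)\<close>. At a vertex \<open>u\<close> these choices form a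
  derangement of the three colors of its neighbors, so one of the two 3-cycles: as soon as one edge
  at \<open>u\<close> has color \<open>c (\<rho> u v)\<close>, they all do. The same alternative then holds at the adjacent
  vertices, provided that \<open>c (\<rho> u v) = c (\<rho> v u)\<close> (lemma \<open>label_across_edge\<close>), and
  connectedness leaves at most two edge colorings (lemma \<open>ETC_alternative\<close>).

  The identity \<open>c (\<rho> u v) = c (\<rho> v u)\<close> is where the belts enter. The belt through \<open>u\<close> and then
  \<open>v\<close> comes from \<open>\<rho> u (\<rho> u v)\<close> and goes on to \<open>\<rho> v u\<close>. These four consecutive vertices have
  different colors, so \<open>\<rho> v u\<close> has the one color that remains in the closed neighborhood of \<open>u\<close>,
  namely that of \<open>\<rho> u v\<close>.

  Hence \<open>uv \<mapsto> c (\<rho> u (\<rho> u v))\<close> and \<open>uv \<mapsto> c (\<rho> u v)\<close> are well-defined edge colorings, different on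
  every edge, and both yield efficient total colorings. The first gives each edge the color of the
  vertex preceding it on either of its belts, the second the color of the vertex following it; so
  they are directed and reversed. On a 4-cycle with rainbow vertices the edges are rainbow in every
  total coloring: opposite edges must choose from disjoint pairs of colors.\<close>

section \<open>Orbits\<close>

lemma cyclic_on_card_3:
  assumes "cyclic_on f S" "card S = 3" "x \<in> S"
  shows "S = {x, f x, f (f x)}" "f (f (f x)) = x" "distinct [x, f x, f (f x)]"
proof -
  have self: "x \<in> orbit f x" and S: "S = orbit f x"
    using assms by (auto simp: cyclic_on_alldef)
  define n where "n = funpow_dist1 f x x"
  have im: "S = (\<lambda>k. (f ^^ k) x) ` {0..<n}"
    unfolding S n_def by (rule orbit_conv_funpow_dist1[OF self])
  have "card S = n"
    unfolding im n_def by (subst card_image[OF inj_on_funpow_dist1[OF self]]) simp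
  then have n: "n = 3" using assms(2) by simp
  have "{0..<3} = {0, 1, 2::nat}" by auto
  then show eq: "S = {x, f x, f (f x)}"
    using im n by (simp add: numeral_2_eq_2)
  show "f (f (f x)) = x"
    using funpow_dist1_prop[OF self] n unfolding n_def by (simp add: numeral_3_eq_3)
  show "distinct [x, f x, f (f x)]"
    using eq assms(2) by (auto simp: card_insert_if split: if_splits)
qed

lemma funpow_card_orbit:
  assumes "finite A" "inj_on f A" "f ` A \<subseteq> A" "x \<in> A"
  shows "(f ^^ card (orbit f x)) x = x"
proof -
  \<comment> \<open>Replacing \<open>f\<close> by the identity outside \<open>A\<close> turns it into a permutation with the same orbit.\<close>
  define g where "g = perm_restrict f A"
  have "bij_betw f A A"
    using assms by (simp add: bij_betw_def endo_inj_surj)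
  then have "bij_betw g A A"
    by (rule bij_betw_cong[THEN iffD1, rotated]) (simp add: g_def perm_restrict_def)
  then have "g permutes A"
    by (rule bij_imp_permutes) (simp add: g_def perm_restrict_def)
  then have "permutation g" using assms(1) by (auto simp: permutation_permutes)
  then have "x \<in> orbit g x" by (rule permutation_self_in_orbit)
  moreover have "orbit f x = orbit g x"
    using assms by (intro orbit_cong0[of _ A]) (auto simp: g_def perm_restrict_def)
  ultimately have self: "x \<in> orbit f x" by metis
  have "card (orbit f x) = funpow_dist1 f x x"
    by (subst orbit_conv_funpow_dist1[OF self], subst card_image[OF inj_on_funpow_dist1[OF self]])
      simp
  then show ?thesis using funpow_dist1_prop[OF self] by simp
qed


section \<open>Labels around a vertex, along a belt and across an edge\<close>

text \<open>A cubic map with a labelling of the vertices as in a Pi-map.\<close>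

locale labelled_cubic_map =
  fixes V :: "'a set" and E :: "'a set set" and \<rho> :: "'a \<Rightarrow> 'a \<Rightarrow> 'a" and c :: "'a \<Rightarrow> nat"
  assumes simple: "simple_graph V E"
    and cubic: "cubic_graph V E"
    and rotation: "rotation_system V E \<rho>"
    and labelling: "Pi_labelling V E \<rho> c"
begin

lemma edgeD:
  assumes "{u, v} \<in> E"
  shows "{v, u} \<in> E" "u \<noteq> v" "u \<in> V" "v \<in> V"
proof -
  have "{u, v} \<subseteq> V" "card {u, v} = 2" using simple assms by (auto simp: simple_graph_def)
  then show "u \<noteq> v" "u \<in> V" "v \<in> V" by auto
  show "{v, u} \<in> E" using assms by (simp add: insert_commute)
qed

lemma edgeE:
  assumes "e \<in> E"
  obtains u v where "e = {u, v}" "{u, v} \<in> E"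
proof -
  have "card e = 2" using simple assms by (auto simp: simple_graph_def)
  then show ?thesis using that assms by (auto simp: card_2_iff)
qed

lemma rotation_neighbor:
  assumes "{u, v} \<in> E"
  shows "{u, \<rho> u v} \<in> E" "\<rho> u (\<rho> u (\<rho> u v)) = v" "distinct [v, \<rho> u v, \<rho> u (\<rho> u v)]"
    "neighbors E u = {v, \<rho> u v, \<rho> u (\<rho> u v)}"
proof -
  have "cyclic_on (\<rho> u) (neighbors E u)" "card (neighbors E u) = 3" "v \<in> neighbors E u"
    using rotation cubic edgeD[OF assms] assms
    by (auto simp: rotation_system_def cubic_graph_def neighbors_def)
  note * = cyclic_on_card_3[OF this]
  show "\<rho> u (\<rho> u (\<rho> u v)) = v" "distinct [v, \<rho> u v, \<rho> u (\<rho> u v)]"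
    "neighbors E u = {v, \<rho> u v, \<rho> u (\<rho> u v)}" using * by auto
  have "\<rho> u v \<in> neighbors E u" using *(1) by simp
  then show "{u, \<rho> u v} \<in> E" by (simp add: neighbors_def)
qed

lemma label_in_colors: "v \<in> V \<Longrightarrow> c v \<in> colors"
  using labelling by (auto simp: Pi_labelling_def EDS_partition_def)

text \<open>The four efficient dominating sets meet each closed neighborhood in one vertex each.\<close>

lemma closed_neighbors_rainbow:
  assumes "v \<in> V"
  shows "bij_betw c (closed_neighbors E v) colors"
proof -
  have sub: "closed_neighbors E v \<subseteq> V"
    using assms edgeD by (auto simp: closed_neighbors_def neighbors_def)
  have one: "card (closed_neighbors E v \<inter> color_class V c i) = 1" if "i \<in> colors" for i
    using labelling assms that by (auto simp: Pi_labelling_def EDS_partition_def EDS_def)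
  have "inj_on c (closed_neighbors E v)"
  proof (rule inj_onI)
    fix x y assume xy: "x \<in> closed_neighbors E v" "y \<in> closed_neighbors E v" "c x = c y"
    then have "c x \<in> colors" using sub label_in_colors by auto
    from one[OF this] obtain z where "closed_neighbors E v \<inter> color_class V c (c x) = {z}"
      by (auto simp: card_1_singleton_iff)
    moreover have "x \<in> closed_neighbors E v \<inter> color_class V c (c x)"
      "y \<in> closed_neighbors E v \<inter> color_class V c (c x)"
      using xy sub by (auto simp: color_class_def)
    ultimately show "x = y" by auto
  qed
  moreover have "c ` closed_neighbors E v = colors"
  proof (intro equalityI subsetI)
    show "i \<in> colors" if "i \<in> c ` closed_neighbors E v" for i
      using that sub label_in_colors by auto
    show "i \<in> c ` closed_neighbors E v" if i: "i \<in> colors" for i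
    proof -
      obtain z where "closed_neighbors E v \<inter> color_class V c i = {z}"
        using one[OF i] by (auto simp: card_1_singleton_iff)
      then have "z \<in> closed_neighbors E v" "c z = i" by (auto simp: color_class_def)
      then show ?thesis by blast
    qed
  qed
  ultimately show ?thesis by (simp add: bij_betw_def)
qed

lemma labels_at_edge:
  assumes "{u, v} \<in> E"
  shows "distinct [c u, c v, c (\<rho> u v), c (\<rho> u (\<rho> u v))]"
    "colors = {c u, c v, c (\<rho> u v), c (\<rho> u (\<rho> u v))}"
proof -
  note r = rotation_neighbor[OF assms]
  have cn: "closed_neighbors E u = {u, v, \<rho> u v, \<rho> u (\<rho> u v)}"
    using r(4) by (simp add: closed_neighbors_def)
  have "u \<noteq> v" "u \<noteq> \<rho> u v" "u \<noteq> \<rho> u (\<rho> u v)"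
    using edgeD(2)[OF assms] edgeD(2)[OF r(1)] edgeD(2)[OF rotation_neighbor(1)[OF r(1)]] by auto
  moreover have "inj_on c {u, v, \<rho> u v, \<rho> u (\<rho> u v)}"
    and im: "c ` {u, v, \<rho> u v, \<rho> u (\<rho> u v)} = colors"
    using closed_neighbors_rainbow[OF edgeD(3)[OF assms]] cn by (auto simp: bij_betw_def)
  ultimately show "distinct [c u, c v, c (\<rho> u v), c (\<rho> u (\<rho> u v))]"
    using r(3) by (auto simp: inj_on_def)
  show "colors = {c u, c v, c (\<rho> u v), c (\<rho> u (\<rho> u v))}" using im by simp
qed

lemma finite_darts: "finite (darts E)"
proof (rule finite_subset)
  show "darts E \<subseteq> V \<times> V" using edgeD by (auto simp: darts_def)
  show "finite (V \<times> V)" using simple by (simp add: simple_graph_def)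
qed

lemma face_step_dart: "d \<in> darts E \<Longrightarrow> face_step \<rho> d \<in> darts E"
  using rotation_neighbor(1) edgeD(1) by (auto simp: darts_def face_step_def)

lemma funpow_face_step_dart: "d \<in> darts E \<Longrightarrow> (face_step \<rho> ^^ i) d \<in> darts E"
  by (induction i) (auto simp: face_step_dart)

lemma face_step_inj: "inj_on (face_step \<rho>) (darts E)"
proof (rule inj_onI)
  fix d d' assume "d \<in> darts E" "d' \<in> darts E" and eq: "face_step \<rho> d = face_step \<rho> d'"
  moreover obtain u v u' v' where "d = (u, v)" "d' = (u', v')" by fastforce
  ultimately have "{u, v} \<in> E" "{u', v'} \<in> E" "v = v'" "\<rho> v u = \<rho> v u'" "d = (u, v)" "d' = (u', v')"
    by (auto simp: darts_def face_step_def)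
  then show "d = d'" using rotation_neighbor(2) edgeD(1) by metis
qed

lemma face_period:
  assumes "d \<in> darts E"
  shows "(face_step \<rho> ^^ card (orbit (face_step \<rho>) d)) d = d"
  using assms finite_darts face_step_inj face_step_dart by (intro funpow_card_orbit) auto

lemma orbit_face_step_card_pos:
  assumes "d \<in> darts E"
  shows "card (orbit (face_step \<rho>) d) > 0"
proof -
  have "orbit (face_step \<rho>) d \<subseteq> darts E"
    using funpow_face_step_dart[OF assms] by (auto simp: orbit_altdef)
  then show ?thesis
    using finite_darts finite_subset orbit_nonempty by (metis card_gt_0_iff)
qed

text \<open>Belts may start anywhere, so only the first period of the label sequence is needed.\<close>

lemma belt_labels_distinct:
  assumes "{u, v} \<in> E"
  shows "distinct [c u, c v, c (\<rho> v u), c (\<rho> (\<rho> v u) v)]"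
proof -
  define d where "d = (u, v)"
  define n where "n = card (orbit (face_step \<rho>) d)"
  have d: "d \<in> darts E" using assms by (simp add: d_def darts_def)
  define p where "p = map (\<lambda>i. fst ((face_step \<rho> ^^ i) d)) [0..<n]"
  have "belt E \<rho> p" using d by (auto simp: belt_def p_def n_def)
  then obtain i j k l m where ijkl: "{i, j, k, l} = colors"
    and per: "map c p = concat (replicate m [i, j, k, l])"
    using labelling unfolding Pi_labelling_def by metis
  have len: "length p = n" by (simp add: p_def)
  have "length (map c p) = 4 * m" unfolding per by (induction m) auto
  then have n4m: "n = 4 * m" using len by simp
  then have "m \<noteq> 0" using orbit_face_step_card_pos[OF d] n_def by auto
  then obtain m' where m': "m = Suc m'" using not0_implies_Suc by blast
  have four: "take 4 (map c p) = [i, j, k, l]" unfolding per m' by simp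
  have "take 4 [0..<n] = [0, 1, 2, 3]"
    using n4m m' by (simp add: take_upt upt_rec numeral_eq_Suc)
  then have "take 4 (map c p) = map (\<lambda>i. c (fst ((face_step \<rho> ^^ i) d))) [0, 1, 2, 3]"
    by (simp add: p_def take_map)
  also have "\<dots> = [c u, c v, c (\<rho> v u), c (\<rho> (\<rho> v u) v)]"
    by (simp add: d_def face_step_def numeral_eq_Suc)
  finally have "[c u, c v, c (\<rho> v u), c (\<rho> (\<rho> v u) v)] = [i, j, k, l]" using four by simp
  moreover have "card {i, j, k, l} = 4" unfolding ijkl by (simp add: colors_def)
  then have "distinct [i, j, k, l]" by (intro card_distinct) simp
  ultimately show ?thesis by simp
qed

lemma label_across_edge:
  assumes "{u, v} \<in> E"
  shows "c (\<rho> u v) = c (\<rho> v u)"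
proof -
  \<comment> \<open>The predecessor of \<open>u\<close> on the belt with \<open>v\<close> after \<open>u\<close>.\<close>
  define w where "w = \<rho> u (\<rho> u v)"
  note r = rotation_neighbor[OF assms]
  have uw: "{u, w} \<in> E" using rotation_neighbor(1)[OF r(1)] by (simp add: w_def)
  have "\<rho> u w = v" using r(2) by (simp add: w_def)
  then have "distinct [c w, c u, c v, c (\<rho> v u)]"
    using belt_labels_distinct[OF edgeD(1)[OF uw]] by simp
  moreover have "c (\<rho> v u) \<in> {c u, c v, c (\<rho> u v), c w}"
    using labels_at_edge(2)[OF assms] label_in_colors[OF edgeD(4)]
      rotation_neighbor(1)[OF edgeD(1)[OF assms]] by (metis w_def)
  ultimately show ?thesis by auto
qed

lemma label_across_edge2:
  assumes "{u, v} \<in> E"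
  shows "c (\<rho> u (\<rho> u v)) = c (\<rho> v (\<rho> v u))"
proof -
  note a = labels_at_edge[OF assms] and b = labels_at_edge[OF edgeD(1)[OF assms]]
  have "c (\<rho> u (\<rho> u v)) \<in> {c v, c u, c (\<rho> v u), c (\<rho> v (\<rho> v u))}"
    using a(2) b(2) by auto
  then show ?thesis using a(1) label_across_edge[OF assms] by auto
qed

end


section \<open>The two edge colorings\<close>

text \<open>The edge \<open>uv\<close> gets the color of \<open>\<sigma> u v\<close>. This is meaningful when \<open>c (\<sigma> u v) = c (\<sigma> v u)\<close> for all
  edges; the result is extensional on \<open>E\<close>.\<close>

definition induced_edge_coloring ::
    "'a set set \<Rightarrow> ('a \<Rightarrow> nat) \<Rightarrow> ('a \<Rightarrow> 'a \<Rightarrow> 'a) \<Rightarrow> 'a set \<Rightarrow> nat" where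
  "induced_edge_coloring E c \<sigma> = (\<lambda>e\<in>E. THE k. \<forall>u v. e = {u, v} \<longrightarrow> k = c (\<sigma> u v))"

lemma induced_edge_coloring_edge:
  assumes "\<And>u v. {u, v} \<in> E \<Longrightarrow> c (\<sigma> u v) = c (\<sigma> v u)" "{u, v} \<in> E"
  shows "induced_edge_coloring E c \<sigma> {u, v} = c (\<sigma> u v)"
proof -
  have "(THE k. \<forall>x y. {u, v} = {x, y} \<longrightarrow> k = c (\<sigma> x y)) = c (\<sigma> u v)"
    using assms by (intro the_equality) (auto simp: doubleton_eq_iff)
  then show ?thesis using assms(2) by (simp add: induced_edge_coloring_def)
qed

text \<open>On a 4-cycle \<open>abcd\<close> with rainbow vertices, \<open>ab\<close> takes the color of \<open>c\<close> or \<open>d\<close>, and \<open>cd\<close> that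
  of \<open>a\<close> or \<open>b\<close>; so opposite edges differ, and adjacent ones differ anyway.\<close>

lemma ETGC_if_ETC:
  assumes etc: "ETC V E \<mu>"
    and vertices: "\<And>p. graph_cycle E p \<Longrightarrow> length p = 4 \<Longrightarrow> bij_betw (fst \<mu>) (set p) colors"
  shows "ETGC V E \<mu>"
proof -
  have "bij_betw (snd \<mu>) (walk_edge p ` {..<4}) colors"
    if p: "graph_cycle E p" "length p = 4" for p
  proof -
    obtain a b c d where abcd: "p = [a, b, c, d]"
      using p(2) by (auto simp: length_Suc_conv numeral_eq_Suc)
    have dist: "distinct [a, b, c, d]" using p(1) abcd by (simp add: graph_cycle_def)
    have lt4: "{..<4} = {0, 1, 2, 3::nat}" by auto
    have edges: "walk_edge p ` {..<4} = {{a, b}, {b, c}, {c, d}, {d, a}}"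
      unfolding lt4 by (simp add: walk_edge_def abcd)
    have "\<forall>i<4. walk_edge p i \<in> E" using p by (simp add: graph_cycle_def)
    then have "walk_edge p ` {..<4} \<subseteq> E" by auto
    then have E: "{a, b} \<in> E" "{b, c} \<in> E" "{c, d} \<in> E" "{d, a} \<in> E"
      unfolding edges by auto
    have tc: "total_coloring V E \<mu>" using etc by (simp add: ETC_def)
    have col: "snd \<mu> e \<in> colors" if "e \<in> E" for e
      using tc that by (auto simp: total_coloring_def)
    have adj: "snd \<mu> e \<noteq> snd \<mu> f" if "e \<in> E" "f \<in> E" "e \<noteq> f" "e \<inter> f \<noteq> {}" for e f
      using tc that by (simp add: total_coloring_def)
    have inc: "snd \<mu> {x, y} \<noteq> fst \<mu> x" "snd \<mu> {x, y} \<noteq> fst \<mu> y" if "{x, y} \<in> E" for x y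
      using tc that unfolding total_coloring_def by (metis insertI1 insertI2)+
    have "bij_betw (fst \<mu>) {a, b, c, d} colors" using vertices[OF p] abcd by simp
    then have cols: "colors = {fst \<mu> a, fst \<mu> b, fst \<mu> c, fst \<mu> d}"
      by (auto simp: bij_betw_def)
    have consec: "snd \<mu> {a, b} \<noteq> snd \<mu> {b, c}" "snd \<mu> {b, c} \<noteq> snd \<mu> {c, d}"
      "snd \<mu> {c, d} \<noteq> snd \<mu> {d, a}" "snd \<mu> {d, a} \<noteq> snd \<mu> {a, b}"
      using dist by (intro adj E; auto simp: doubleton_eq_iff)+
    have choice: "snd \<mu> {a, b} \<in> {fst \<mu> c, fst \<mu> d}" "snd \<mu> {c, d} \<in> {fst \<mu> a, fst \<mu> b}"
      "snd \<mu> {b, c} \<in> {fst \<mu> a, fst \<mu> d}" "snd \<mu> {d, a} \<in> {fst \<mu> b, fst \<mu> c}"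
      using col[OF E(1)] col[OF E(2)] col[OF E(3)] col[OF E(4)]
        inc[OF E(1)] inc[OF E(2)] inc[OF E(3)] inc[OF E(4)] unfolding cols by auto
    have "card {fst \<mu> a, fst \<mu> b, fst \<mu> c, fst \<mu> d} = 4"
      unfolding cols[symmetric] by (simp add: colors_def)
    then have "distinct [fst \<mu> a, fst \<mu> b, fst \<mu> c, fst \<mu> d]"
      by (intro card_distinct) simp
    then have disjoint: "{fst \<mu> c, fst \<mu> d} \<inter> {fst \<mu> a, fst \<mu> b} = {}"
      "{fst \<mu> a, fst \<mu> d} \<inter> {fst \<mu> b, fst \<mu> c} = {}" by auto
    have "snd \<mu> {a, b} \<noteq> snd \<mu> {c, d}"
      using choice(1,2) disjoint(1) by (metis disjoint_iff)
    moreover have "snd \<mu> {b, c} \<noteq> snd \<mu> {d, a}"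
      using choice(3,4) disjoint(2) by (metis disjoint_iff)
    ultimately have four: "distinct [snd \<mu> {a, b}, snd \<mu> {b, c}, snd \<mu> {c, d}, snd \<mu> {d, a}]"
      using consec by simp
    then have inj: "inj_on (snd \<mu>) (walk_edge p ` {..<4})"
      unfolding edges by (auto simp: inj_on_def)
    have "snd \<mu> ` walk_edge p ` {..<4} = colors"
    proof (rule card_seteq)
      show "finite colors" by (simp add: colors_def)
      show "snd \<mu> ` walk_edge p ` {..<4} \<subseteq> colors" unfolding edges using E col by auto
      have "snd \<mu> ` walk_edge p ` {..<4}
          = set [snd \<mu> {a, b}, snd \<mu> {b, c}, snd \<mu> {c, d}, snd \<mu> {d, a}]"
        unfolding edges by simp
      then have "card (snd \<mu> ` walk_edge p ` {..<4}) = 4"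
        using distinct_card[OF four] by simp
      then show "card colors \<le> card (snd \<mu> ` walk_edge p ` {..<4})" by (simp add: colors_def)
    qed
    then show ?thesis using inj by (simp add: bij_betw_def)
  qed
  then show ?thesis using etc vertices by (simp add: ETGC_def)
qed

context labelled_cubic_map
begin

text \<open>Taking for \<open>\<sigma> u\<close> the rotation \<open>\<rho> u\<close> or its inverse gives the two colorings. What matters is
  that \<open>\<sigma> u\<close> is a derangement of the neighbors of \<open>u\<close>.\<close>

lemma ETC_induced:
  assumes sym: "\<And>u v. {u, v} \<in> E \<Longrightarrow> c (\<sigma> u v) = c (\<sigma> v u)"
    and nbr: "\<And>u v. {u, v} \<in> E \<Longrightarrow> {u, \<sigma> u v} \<in> E \<and> \<sigma> u v \<noteq> v"
    and inj: "\<And>u. inj_on (\<sigma> u) (neighbors E u)"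
  shows "ETC V E (c, induced_edge_coloring E c \<sigma>)"
proof -
  have col: "induced_edge_coloring E c \<sigma> {u, v} = c (\<sigma> u v)" if "{u, v} \<in> E" for u v
    by (rule induced_edge_coloring_edge) (use sym that in auto)
  have labels_ne: "c x \<noteq> c y" if "{u, x} \<in> E" "{u, y} \<in> E" "x \<noteq> y" for u x y
    using closed_neighbors_rainbow[of u] edgeD[OF that(1)] that
    by (auto simp: bij_betw_def inj_on_def closed_neighbors_def neighbors_def)
  have ends_ne: "c u \<noteq> c v" if "{u, v} \<in> E" for u v
    using labels_at_edge(1)[OF that] by simp
  have proper: "c (\<sigma> u v) \<noteq> c u" "c (\<sigma> u v) \<noteq> c v" if "{u, v} \<in> E" for u v
    using nbr[OF that] ends_ne[of u "\<sigma> u v"] labels_ne[of u "\<sigma> u v" v] that by auto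
  have adj: "induced_edge_coloring E c \<sigma> e \<noteq> induced_edge_coloring E c \<sigma> f"
    if ef: "e \<in> E" "f \<in> E" "e \<noteq> f" "e \<inter> f \<noteq> {}" for e f
  proof -
    obtain u where u: "u \<in> e" "u \<in> f" using ef by auto
    have other_end: "\<exists>x. g = {u, x}" if "g \<in> E" "u \<in> g" for g
      using edgeE[OF that(1)] that(2) by (metis insertE insert_commute singletonD)
    obtain v w where e: "e = {u, v}" and f: "f = {u, w}"
      using other_end[OF ef(1) u(1)] other_end[OF ef(2) u(2)] by blast
    have "v \<noteq> w" using ef(3) e f by auto
    then have "\<sigma> u v \<noteq> \<sigma> u w"
      using inj_onD[OF inj, of u v w] ef(1,2) e f by (auto simp: neighbors_def)
    then have "c (\<sigma> u v) \<noteq> c (\<sigma> u w)"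
      using labels_ne[of u "\<sigma> u v" "\<sigma> u w"] nbr ef e f by auto
    then show ?thesis using col ef e f by auto
  qed
  have inc: "c v \<noteq> induced_edge_coloring E c \<sigma> e" if e: "e \<in> E" "v \<in> e" for e v
  proof -
    obtain x y where xy: "e = {x, y}" "{x, y} \<in> E" using edgeE[OF e(1)] by blast
    show ?thesis using proper[OF xy(2)] col[OF xy(2)] e(2) xy(1) by auto
  qed
  have range: "induced_edge_coloring E c \<sigma> \<in> E \<rightarrow>\<^sub>E colors"
  proof (rule PiE_I)
    fix e assume "e \<in> E"
    then obtain u v where uv: "e = {u, v}" "{u, v} \<in> E" using edgeE by blast
    then show "induced_edge_coloring E c \<sigma> e \<in> colors"
      using col label_in_colors edgeD(4) nbr by metis
  qed (simp add: induced_edge_coloring_def)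
  have part: "EDS_partition V E c" using labelling by (simp add: Pi_labelling_def)
  then have "c \<in> V \<rightarrow>\<^sub>E colors" by (simp add: EDS_partition_def)
  then have "total_coloring V E (c, induced_edge_coloring E c \<sigma>)"
    using range adj inc ends_ne by (simp add: total_coloring_def)
  then show ?thesis using closed_neighbors_rainbow part by (simp add: ETC_def)
qed

text \<open>Each edge gets the label of the vertex that follows it, in clockwise direction, on a belt.\<close>

definition reversed_coloring :: "'a set \<Rightarrow> nat" where
  "reversed_coloring = induced_edge_coloring E c \<rho>"

text \<open>Each edge gets the label of the vertex that precedes it on a belt. On three neighbors the
  square of the rotation is its inverse, so the belt with \<open>v\<close> after \<open>u\<close> comes from
  \<open>\<rho> u (\<rho> u v)\<close>.\<close>

definition directed_coloring :: "'a set \<Rightarrow> nat" where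
  "directed_coloring = induced_edge_coloring E c (\<lambda>u v. \<rho> u (\<rho> u v))"

lemma reversed_coloring_edge: "{u, v} \<in> E \<Longrightarrow> reversed_coloring {u, v} = c (\<rho> u v)"
  unfolding reversed_coloring_def
  by (rule induced_edge_coloring_edge[of E c \<rho>, OF label_across_edge])

lemma directed_coloring_edge: "{u, v} \<in> E \<Longrightarrow> directed_coloring {u, v} = c (\<rho> u (\<rho> u v))"
  unfolding directed_coloring_def
  by (rule induced_edge_coloring_edge[of E c "\<lambda>u v. \<rho> u (\<rho> u v)", OF label_across_edge2])

lemma rotation_inj: "inj_on (\<rho> u) (neighbors E u)"
  by (rule inj_onI) (metis (no_types, lifting) mem_Collect_eq neighbors_def rotation_neighbor(2))

lemma ETC_reversed: "ETC V E (c, reversed_coloring)"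
  unfolding reversed_coloring_def
proof (rule ETC_induced)
  show "c (\<rho> u v) = c (\<rho> v u)" if "{u, v} \<in> E" for u v using label_across_edge[OF that] .
  show "{u, \<rho> u v} \<in> E \<and> \<rho> u v \<noteq> v" if "{u, v} \<in> E" for u v
    using rotation_neighbor[OF that] by auto
  show "inj_on (\<rho> u) (neighbors E u)" for u by (rule rotation_inj)
qed

lemma ETC_directed: "ETC V E (c, directed_coloring)"
  unfolding directed_coloring_def
proof (rule ETC_induced)
  show "c (\<rho> u (\<rho> u v)) = c (\<rho> v (\<rho> v u))" if "{u, v} \<in> E" for u v
    using label_across_edge2[OF that] .
  show "{u, \<rho> u (\<rho> u v)} \<in> E \<and> \<rho> u (\<rho> u v) \<noteq> v" if "{u, v} \<in> E" for u v
    using rotation_neighbor[OF that] rotation_neighbor(1)[OF rotation_neighbor(1)[OF that]] by auto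
  show "inj_on (\<lambda>v. \<rho> u (\<rho> u v)) (neighbors E u)" for u
    by (rule inj_onI) (metis (no_types, lifting) mem_Collect_eq neighbors_def rotation_neighbor(2))
qed

lemma directed_reversed_differ:
  assumes "e \<in> E"
  shows "directed_coloring e \<noteq> reversed_coloring e"
proof -
  obtain u v where uv: "e = {u, v}" "{u, v} \<in> E" using edgeE[OF assms] by blast
  then show ?thesis
    using labels_at_edge(1)[OF uv(2)] directed_coloring_edge reversed_coloring_edge by simp
qed


section \<open>Directed and reversed belts\<close>

text \<open>With indices taken cyclically, a belt lists the sources of the iterates of a dart under the
  face permutation.\<close>

lemma beltE:
  assumes "belt E \<rho> p"
  obtains d where "\<And>i. (face_step \<rho> ^^ i) d \<in> darts E" "length p > 0"
    "\<And>i. p ! (i mod length p) = fst ((face_step \<rho> ^^ i) d)"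
proof -
  obtain d where d: "d \<in> darts E"
    and p: "p = map (\<lambda>i. fst ((face_step \<rho> ^^ i) d)) [0..<card (orbit (face_step \<rho>) d)]"
    using assms by (auto simp: belt_def)
  have len: "length p = card (orbit (face_step \<rho>) d)" by (simp add: p)
  have pos: "length p > 0" using orbit_face_step_card_pos[OF d] len by simp
  have "p ! (i mod length p) = fst ((face_step \<rho> ^^ i) d)" for i
  proof -
    have "i mod length p < length p" using pos by simp
    then have "p ! (i mod length p) = fst ((face_step \<rho> ^^ (i mod length p)) d)"
      unfolding len by (subst p) simp
    also have "\<dots> = fst ((face_step \<rho> ^^ i) d)"
      using face_period[OF d] len by (simp add: funpow_mod_eq)
    finally show ?thesis .
  qed
  then show ?thesis using that[OF funpow_face_step_dart[OF d]] pos by blast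
qed

lemma belt_edge_labels:
  assumes "belt E \<rho> p"
  shows "directed_coloring (walk_edge p (Suc i mod length p)) = c (p ! (i mod length p))"
    and "reversed_coloring (walk_edge p (i mod length p)) = c (p ! ((i + 2) mod length p))"
proof -
  obtain d where dart: "\<And>i. (face_step \<rho> ^^ i) d \<in> darts E" and "length p > 0"
    and at: "\<And>i. p ! (i mod length p) = fst ((face_step \<rho> ^^ i) d)"
    using beltE[OF assms] by blast
  have edge: "walk_edge p (j mod length p) = {p ! (j mod length p), p ! (Suc j mod length p)}" for j
    by (simp add: walk_edge_def mod_Suc_eq)
  obtain w u where wu: "(face_step \<rho> ^^ i) d = (w, u)" by fastforce
  have E: "{u, w} \<in> E" using dart[of i] wu edgeD(1) by (simp add: darts_def)
  have "p ! (i mod length p) = w" "p ! (Suc i mod length p) = u"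
    "p ! (Suc (Suc i) mod length p) = \<rho> u w"
    unfolding at using wu by (simp_all add: face_step_def)
  moreover have "directed_coloring {u, \<rho> u w} = c w"
    using directed_coloring_edge[OF rotation_neighbor(1)[OF E]] rotation_neighbor(2)[OF E] by simp
  moreover have "reversed_coloring {w, u} = c (\<rho> u w)"
    using reversed_coloring_edge[OF E] by (simp add: insert_commute)
  ultimately show
    "directed_coloring (walk_edge p (Suc i mod length p)) = c (p ! (i mod length p))"
    "reversed_coloring (walk_edge p (i mod length p)) = c (p ! ((i + 2) mod length p))"
    using edge[of i] edge[of "Suc i"] by simp_all
qed

lemma directed_belts:
  assumes "belt E \<rho> p"
  shows "directed_belt (c, directed_coloring) p"
  unfolding directed_belt_def
proof (intro allI impI)
  fix i assume i: "i < length p" and "snd (c, directed_coloring) (walk_edge p i) = 0"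
  \<comment> \<open>The cyclic predecessor of \<open>i\<close>.\<close>
  define j where "j = (i + length p - 1) mod length p"
  have "Suc (i + length p - 1) = i + length p" using i by simp
  then have eq: "Suc (i + length p - 1) mod length p = i" using i by simp
  have "fst (c, directed_coloring) (p ! j) = 0"
    using belt_edge_labels(1)[OF assms, of "i + length p - 1"] eq
      \<open>snd (c, directed_coloring) (walk_edge p i) = 0\<close> by (simp add: j_def)
  moreover have "i = (j + 1) mod length p"
    using eq by (simp add: j_def mod_Suc_eq)
  moreover have "j < length p" using i unfolding j_def by (intro mod_less_divisor) linarith
  ultimately show "\<exists>j<length p. fst (c, directed_coloring) (p ! j) = 0 \<and> i = (j + 1) mod length p"
    by blast
qed

lemma reversed_belts:
  assumes "belt E \<rho> p"
  shows "reversed_belt (c, reversed_coloring) p"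
  unfolding reversed_belt_def
proof (intro allI impI)
  fix i assume i: "i < length p" and "snd (c, reversed_coloring) (walk_edge p i) = 0"
  then have "fst (c, reversed_coloring) (p ! ((i + 2) mod length p)) = 0"
    using belt_edge_labels(2)[OF assms, of i] by simp
  moreover have "(i + 2) mod length p < length p" using i by (intro mod_less_divisor) linarith
  ultimately show
    "\<exists>j<length p. fst (c, reversed_coloring) (p ! j) = 0 \<and> j = (i + 2) mod length p"
    by blast
qed


section \<open>Uniqueness\<close>

text \<open>If the edge \<open>uv\<close> has the color of \<open>\<rho> u v\<close>, then the edge from \<open>u\<close> to \<open>\<rho> u (\<rho> u v)\<close>, which may
  only have the colors of \<open>v\<close> and \<open>\<rho> u v\<close>, has that of \<open>v\<close>. So the choice made at one edge
  passes to the edge one position back, propagates around \<open>u\<close>, and from there through the graph.\<close>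

lemma ETC_alternative:
  assumes conn: "connected_graph V E" and etc: "ETC V E (c, f)"
  shows "f = directed_coloring \<or> f = reversed_coloring"
proof -
  have tc: "total_coloring V E (c, f)" using etc by (simp add: ETC_def)
  have adj: "f e \<noteq> f e'" if "e \<in> E" "e' \<in> E" "e \<noteq> e'" "e \<inter> e' \<noteq> {}" for e e'
    using tc that by (simp add: total_coloring_def)
  have choice: "f {u, v} = c (\<rho> u v) \<or> f {u, v} = c (\<rho> u (\<rho> u v))" if "{u, v} \<in> E" for u v
  proof -
    have "f {u, v} \<in> colors" "f {u, v} \<noteq> c u" "f {u, v} \<noteq> c v"
      using tc that by (auto simp: total_coloring_def)
    then show ?thesis using labels_at_edge(2)[OF that] by auto
  qed
  have prev: "f {u, \<rho> u (\<rho> u v)} = c v" if uv: "{u, v} \<in> E" "f {u, v} = c (\<rho> u v)" for u v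
  proof -
    note r = rotation_neighbor[OF uv(1)]
    have w: "{u, \<rho> u (\<rho> u v)} \<in> E" using rotation_neighbor(1)[OF r(1)] .
    have "f {u, \<rho> u (\<rho> u v)} \<noteq> f {u, v}"
      using w uv(1) r(3) by (intro adj) (auto simp: doubleton_eq_iff)
    then show ?thesis using choice[OF w] r(2) uv(2) by auto
  qed
  have around: "f {u, w} = c (\<rho> u w)"
    if uv: "{u, v} \<in> E" "f {u, v} = c (\<rho> u v)" and w: "{u, w} \<in> E" for u v w
  proof -
    note r = rotation_neighbor[OF uv(1)]
    have v2: "{u, \<rho> u (\<rho> u v)} \<in> E" using rotation_neighbor(1)[OF r(1)] .
    have f2: "f {u, \<rho> u (\<rho> u v)} = c (\<rho> u (\<rho> u (\<rho> u v)))" using prev[OF uv] r(2) by simp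
    have "f {u, \<rho> u v} = c (\<rho> u (\<rho> u v))" using prev[OF v2 f2] r(2) by simp
    moreover have "w \<in> {v, \<rho> u v, \<rho> u (\<rho> u v)}" using w r(4) by (auto simp: neighbors_def)
    ultimately show ?thesis using f2 uv(2) by auto
  qed
  have eqI: "f = g"
    if g: "g \<in> extensional E" and eq: "\<And>u v. {u, v} \<in> E \<Longrightarrow> f {u, v} = g {u, v}" for g
  proof (rule extensionalityI[of _ E])
    show "f \<in> extensional E" using tc by (auto simp: total_coloring_def PiE_def)
    show "f e = g e" if "e \<in> E" for e using edgeE[OF that] eq by metis
  qed (fact g)
  show ?thesis
  proof (cases "\<exists>u v. {u, v} \<in> E \<and> f {u, v} = c (\<rho> u v)")
    case True
    then obtain u v where uv: "{u, v} \<in> E" "f {u, v} = c (\<rho> u v)" by blast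
    have all: "\<forall>y. {x, y} \<in> E \<longrightarrow> f {x, y} = c (\<rho> x y)" if "x \<in> V" for x
    proof -
      have "(u, x) \<in> {(x, y). {x, y} \<in> E}\<^sup>*"
        using conn edgeD(3)[OF uv(1)] that by (simp add: connected_graph_def)
      then show ?thesis
      proof (induction rule: rtrancl_induct)
        case base
        then show ?case using around[OF uv] by blast
      next
        case (step y z)
        then have yz: "{y, z} \<in> E" "f {y, z} = c (\<rho> y z)" by auto
        then have "f {z, y} = c (\<rho> z y)"
          using label_across_edge[OF yz(1)] by (simp add: insert_commute)
        then show ?case using around[OF edgeD(1)[OF yz(1)]] by blast
      qed
    qed
    have "f = reversed_coloring"
    proof (rule eqI)
      show "reversed_coloring \<in> extensional E"
        by (simp add: reversed_coloring_def induced_edge_coloring_def)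
      show "f {u, v} = reversed_coloring {u, v}" if "{u, v} \<in> E" for u v
        using all[OF edgeD(3)[OF that]] reversed_coloring_edge[OF that] that by simp
    qed
    then show ?thesis ..
  next
    case False
    have "f = directed_coloring"
    proof (rule eqI)
      show "directed_coloring \<in> extensional E"
        by (simp add: directed_coloring_def induced_edge_coloring_def)
      show "f {u, v} = directed_coloring {u, v}" if "{u, v} \<in> E" for u v
        using choice[OF that] False that directed_coloring_edge[OF that] by auto
    qed
    then show ?thesis ..
  qed
qed

end


theorem lemma27:
  fixes V :: "'a set" and E :: "'a set set" and \<rho> :: "'a \<Rightarrow> 'a \<Rightarrow> 'a"
    and \<mu> :: "'a coloring" and \<mu>\<^sub>V :: "'a \<Rightarrow> nat"
  assumes "simple_graph V E"
    and "connected_graph V E"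
    and "cubic_graph V E"
    and "graph_girth E = 4"
    and "Pi_map V E \<rho>"
    and "Pi_map_ETGC V E \<rho> \<mu>"
    and "\<mu>\<^sub>V = fst \<mu>"
  shows "\<exists>\<mu>D \<mu>R.
    orthogonal_edge_colorings V E \<mu>D \<mu>R \<and>
    orthogonal_ETCs V E (\<mu>\<^sub>V, \<mu>D) (\<mu>\<^sub>V, \<mu>R) \<and>
    DETGC V E \<rho> (\<mu>\<^sub>V, \<mu>D) \<and>
    RETGC V E \<rho> (\<mu>\<^sub>V, \<mu>R) \<and>
    (\<forall>\<nu>. Pi_map_ETGC V E \<rho> \<nu> \<and> fst \<nu> = \<mu>\<^sub>V \<longrightarrow> \<nu> = (\<mu>\<^sub>V, \<mu>D) \<or> \<nu> = (\<mu>\<^sub>V, \<mu>R))"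
proof -
  have etgc: "ETGC V E \<mu>" and label: "Pi_labelling V E \<rho> \<mu>\<^sub>V"
    using assms(6,7) by (auto simp: Pi_map_ETGC_def)
  have rot: "rotation_system V E \<rho>"
    using assms(5) by (simp add: Pi_map_def Y_map_def graph_map_def)
  interpret labelled_cubic_map V E \<rho> \<mu>\<^sub>V
    using assms(1,3) rot label by unfold_locales
  have Pi: "Pi_map_ETGC V E \<rho> (\<mu>\<^sub>V, f)" if "ETC V E (\<mu>\<^sub>V, f)" for f
  proof -
    have "ETGC V E (\<mu>\<^sub>V, f)"
      using that etgc assms(7) by (intro ETGC_if_ETC) (auto simp: ETGC_def)
    then show ?thesis using assms(5) label by (simp add: Pi_map_ETGC_def)
  qed
  have orth: "orthogonal_ETCs V E (\<mu>\<^sub>V, directed_coloring) (\<mu>\<^sub>V, reversed_coloring)"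
    using ETC_directed ETC_reversed directed_reversed_differ by (simp add: orthogonal_ETCs_def)
  moreover have "orthogonal_edge_colorings V E directed_coloring reversed_coloring"
    using orth unfolding orthogonal_edge_colorings_def by blast
  moreover have "DETGC V E \<rho> (\<mu>\<^sub>V, directed_coloring)"
    using Pi[OF ETC_directed] directed_belts by (simp add: DETGC_def)
  moreover have "RETGC V E \<rho> (\<mu>\<^sub>V, reversed_coloring)"
    using Pi[OF ETC_reversed] reversed_belts by (simp add: RETGC_def)
  moreover have "\<nu> = (\<mu>\<^sub>V, directed_coloring) \<or> \<nu> = (\<mu>\<^sub>V, reversed_coloring)"
    if "Pi_map_ETGC V E \<rho> \<nu> \<and> fst \<nu> = \<mu>\<^sub>V" for \<nu>
  proof -
    have eq: "\<nu> = (\<mu>\<^sub>V, snd \<nu>)" using that by (simp add: prod_eq_iff)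
    then have "ETC V E (\<mu>\<^sub>V, snd \<nu>)" using that by (simp add: Pi_map_ETGC_def ETGC_def)
    then show ?thesis using ETC_alternative[OF assms(2)] eq by metis
  qed
  ultimately show ?thesis by blast
qed

end
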